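(* Let $U\subset F_{USCB}(\mathbb{R}^m)$. Then $U$ is relatively compact in $(F_{USCB}(\mathbb{R}^m),H_{\rm end})$ if and only if (i) for each $\alpha\in(0,1]$, $U(\alpha):=\bigcup_{u\in U}[u]_\alpha$ is a bounded set in $\mathbb{R}^m$, and (ii$'$) given any sequence $\{u_n:n=1,2,\ldots\}\subset U$, there exist an $r>0$ and a subsequence $\{v_n\}$ of $\{u_n\}$ such that $\lim_{n\to\infty}|v_n|_r=0$.
   Context: A fuzzy set on $\mathbb{R}^m$ is a function $u:\mathbb{R}^m\to[0,1]$. For $\alpha\in(0,1]$, $[u]_\alpha=\{x:u(x)\ge\alpha\}$, and $[u]_0=\overline{\{x:u(x)>0\}}$. $F_{USCG}(\mathbb{R}^m)$ is the set of all upper semi-continuous fuzzy sets $u$ on $\mathbb{R}^m$ with $[u]_\alpha$ bounded for each $\alpha\in(0,1]$; $F_{USCB}(\mathbb{R}^m)$ is the set of all upper semi-continuous fuzzy sets $u$ on $\mathbb{R}^m$ with $[u]_0$ bounded (cuts may be empty). The endograph of $u$ is ${\rm end}\,u=\{(x,t)\in\mathbb{R}^m\times[0,1]:u(x)\ge t\}$, and the endograph metric is $H_{\rm end}(u,v)=H({\rm end}\,u,{\rm end}\,v)$, where $H(A,B)=\max\{\sup_{a\in A}\inf_{b\in B}d(a,b),\ \sup_{b\in B}\inf_{a\in A}d(a,b)\}$ is the Hausdorff metric on nonempty closed sets ($d$ Euclidean). For $r>0$, $B_r=\{x\in\mathbb{R}^m:\|x\|\le r\}$ and $\widehat{B_r}$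 is its characteristic function. For $u\in F_{USCG}(\mathbb{R}^m)$, $|u|_r:=H_{\rm end}(u\vee\widehat{B_r},\widehat{B_r})$, where $\vee$ is the pointwise maximum. A set is relatively compact in a metric space if its closure in that space is compact. *)

theory Defs
  imports "HOL-Analysis.Analysis"
begin

definition fuzzy_set :: "(real ^ 'n \<Rightarrow> real) \<Rightarrow> bool" where
  "fuzzy_set u \<longleftrightarrow> range u \<subseteq> {0..1}"

definition fcut :: "(real ^ 'n \<Rightarrow> real) \<Rightarrow> real \<Rightarrow> (real ^ 'n) set" where
  "fcut u \<alpha> = (if \<alpha> = 0 then closure {x. u x > 0} else {x. u x \<ge> \<alpha>})"

definition upper_semicont :: "(real ^ 'n \<Rightarrow> real) \<Rightarrow> bool" where
  "upper_semicont u \<longleftrightarrow> (\<forall>x c. u x < c \<longrightarrow> (\<forall>\<^sub>F y in nhds x. u y < c))"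

definition F_USCB :: "(real ^ 'n \<Rightarrow> real) set" where
  "F_USCB = {u. fuzzy_set u \<and> upper_semicont u \<and> bounded (fcut u 0)}"

definition endograph :: "(real ^ 'n \<Rightarrow> real) \<Rightarrow> ((real ^ 'n) \<times> real) set" where
  "endograph u = {(x, t). t \<in> {0..1} \<and> t \<le> u x}"

(* Real-valued, with the junk value 0 if a set is empty or a supremum is infinite, so
   that it is nonnegative on all arguments, as Metric_space requires. Endographs of fuzzy
   sets never fall under the junk case: each of them contains every point (x, 0) and has
   heights at most 1. On the product type, dist is the Euclidean distance. *)
definition hausdorff_dist :: "'a::metric_space set \<Rightarrow> 'a set \<Rightarrow> real" where
  "hausdorff_dist A B =
    (if A \<noteq> {} \<and> B \<noteq> {} \<and> bdd_above ((\<lambda>a. infdist a B) ` A) \<and> bdd_above ((\<lambda>b. infdist b A) ` B)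
     then max (SUP a\<in>A. infdist a B) (SUP b\<in>B. infdist b A) else 0)"

definition H_end :: "(real ^ 'n \<Rightarrow> real) \<Rightarrow> (real ^ 'n \<Rightarrow> real) \<Rightarrow> real" where
  "H_end u v = hausdorff_dist (endograph u) (endograph v)"

definition ball_char :: "real \<Rightarrow> real ^ 'n \<Rightarrow> real" where
  "ball_char r = indicator (cball 0 r)"

definition end_norm :: "real \<Rightarrow> (real ^ 'n \<Rightarrow> real) \<Rightarrow> real" where
  "end_norm r u = H_end (\<lambda>x. max (u x) (ball_char r x)) (ball_char r)"

definition relatively_compact_in :: "'a topology \<Rightarrow> 'a set \<Rightarrow> bool" where
  "relatively_compact_in T S \<longleftrightarrow> compactin T (T closure_of S)"

lemma zero_in_endograph: "fuzzy_set u \<Longrightarrow> (x, 0) \<in> endograph u"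
  by (auto simp: fuzzy_set_def endograph_def image_subset_iff)

lemma infdist_endograph_le_1:
  assumes "a \<in> endograph u" "fuzzy_set v"
  shows "infdist a (endograph v) \<le> 1"
proof -
  obtain x t where a: "a = (x, t)" "0 \<le> t" "t \<le> 1"
    using assms(1) by (auto simp: endograph_def)
  have "infdist a (endograph v) \<le> dist a (x, 0)"
    by (intro infdist_le zero_in_endograph assms)
  also have "\<dots> \<le> 1"
    using a by (simp add: dist_prod_def)
  finally show ?thesis .
qed

lemma bdd_above_infdist_endograph:
  "fuzzy_set v \<Longrightarrow> bdd_above ((\<lambda>a. infdist a (endograph v)) ` endograph u)"
  by (auto intro!: bdd_aboveI[where M = 1] infdist_endograph_le_1)

lemma endograph_nonempty: "fuzzy_set u \<Longrightarrow> endograph u \<noteq> {}"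
  using zero_in_endograph by blast

lemma H_end_eq:
  assumes "fuzzy_set u" "fuzzy_set v"
  shows "H_end u v = max (SUP a\<in>endograph u. infdist a (endograph v))
                         (SUP b\<in>endograph v. infdist b (endograph u))"
  using assms
  by (simp add: H_end_def hausdorff_dist_def endograph_nonempty bdd_above_infdist_endograph)

lemma infdist_le_H_end:
  assumes "a \<in> endograph u" "fuzzy_set u" "fuzzy_set v"
  shows "infdist a (endograph v) \<le> H_end u v"
  using cSUP_upper[OF assms(1) bdd_above_infdist_endograph[OF assms(3)]] assms
  by (simp add: H_end_eq max.coboundedI1)

lemma H_end_least:
  assumes "fuzzy_set u" "fuzzy_set v"
    and "\<And>a. a \<in> endograph u \<Longrightarrow> infdist a (endograph v) \<le> c"
    and "\<And>a. a \<in> endograph v \<Longrightarrow> infdist a (endograph u) \<le> c"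
  shows "H_end u v \<le> c"
  unfolding H_end_eq[OF assms(1,2)]
  using assms by (intro max.boundedI cSUP_least endograph_nonempty) auto

lemma hausdorff_dist_nonneg: "hausdorff_dist A B \<ge> 0"
proof (cases "A \<noteq> {} \<and> B \<noteq> {} \<and> bdd_above ((\<lambda>a. infdist a B) ` A) \<and> bdd_above ((\<lambda>b. infdist b A) ` B)")
  case True
  then obtain a where a: "a \<in> A" by blast
  have "0 \<le> infdist a B" by (rule infdist_nonneg)
  also have "\<dots> \<le> (SUP a\<in>A. infdist a B)"
    using True a by (intro cSUP_upper) auto
  finally show ?thesis using True by (simp add: hausdorff_dist_def max.coboundedI1)
qed (auto simp: hausdorff_dist_def)

lemma H_end_commute: "H_end u v = H_end v u"
  by (auto simp: H_end_def hausdorff_dist_def max.commute)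

lemma closed_endograph:
  fixes u :: "real ^ 'n \<Rightarrow> real"
  assumes "upper_semicont u"
  shows "closed (endograph u)"
proof -
  have "open (- endograph u)"
  proof (subst open_prod_def, safe)
    fix x :: "real ^ 'n" and t assume "(x, t) \<notin> endograph u"
    then consider "t \<notin> {0..1}" | "u x < t"
      by (fastforce simp: endograph_def)
    then show "\<exists>A B. open A \<and> open B \<and> (x, t) \<in> A \<times> B \<and> A \<times> B \<subseteq> - endograph u"
    proof cases
      case 1
      then have "open (- {0..1::real})" "t \<in> - {0..1}" by auto
      then show ?thesis
        by (intro exI[of _ UNIV] exI[of _ "- {0..1}"]) (auto simp: endograph_def)
    next
      case 2
      then obtain c where c: "u x < c" "c < t" using dense by blast
      then obtain A where "open A" "x \<in> A" "\<forall>y\<in>A. u y < c"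
        using assms unfolding upper_semicont_def eventually_nhds by blast
      with c show ?thesis
        by (intro exI[of _ A] exI[of _ "{c<..}"]) (fastforce simp: endograph_def)
    qed
  qed
  then show ?thesis by (simp add: closed_def)
qed

lemma endograph_inject:
  assumes "fuzzy_set u" "fuzzy_set v" "endograph u = endograph v"
  shows "u = v"
proof
  fix x
  have "(x, u x) \<in> endograph u" "(x, v x) \<in> endograph v"
    using assms(1,2) by (auto simp: fuzzy_set_def endograph_def image_subset_iff)
  then have "u x \<le> v x" "v x \<le> u x"
    using assms(3) by (auto simp: endograph_def set_eq_iff)
  then show "u x = v x" by simp
qed

lemma infdist_endograph_triangle:
  assumes "fuzzy_set u" "fuzzy_set v" "upper_semicont v" "fuzzy_set w" "a \<in> endograph u"
  shows "infdist a (endograph w) \<le> H_end u v + H_end v w"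
proof -
  obtain b where b: "b \<in> endograph v" "infdist a (endograph v) = dist a b"
    using infdist_attains_inf[OF closed_endograph[OF assms(3)] endograph_nonempty[OF assms(2)]]
    by blast
  have "infdist a (endograph w) \<le> infdist b (endograph w) + dist a b"
    by (rule infdist_triangle)
  also have "infdist b (endograph w) \<le> H_end v w"
    using assms b by (intro infdist_le_H_end)
  also have "dist a b \<le> H_end u v"
    using assms b infdist_le_H_end[of a u v] by simp
  finally show ?thesis by simp
qed

lemma H_end_eq_0D:
  assumes "fuzzy_set u" "fuzzy_set v" "upper_semicont v" "H_end u v = 0"
  shows "endograph u \<subseteq> endograph v"
proof
  fix a assume a: "a \<in> endograph u"
  have "infdist a (endograph v) = 0"
    using infdist_le_H_end[OF a assms(1,2)] assms(4) infdist_nonneg[of a "endograph v"] by simp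
  then show "a \<in> endograph v"
    using in_closed_iff_infdist_zero[OF closed_endograph endograph_nonempty] assms by blast
qed

lemma Metric_space_F_USCB: "Metric_space F_USCB H_end"
proof
  fix u v w :: "real ^ 'n \<Rightarrow> real"
  show "H_end u v = H_end v u" by (rule H_end_commute)
  show "0 \<le> H_end u v" by (simp add: H_end_def hausdorff_dist_nonneg)
  assume "u \<in> F_USCB" "v \<in> F_USCB"
  then have uv: "fuzzy_set u" "fuzzy_set v" "upper_semicont u" "upper_semicont v"
    by (auto simp: F_USCB_def)
  show "H_end u v = 0 \<longleftrightarrow> u = v"
  proof
    assume 0: "H_end u v = 0"
    then have "H_end v u = 0" by (simp add: H_end_commute[of v u])
    with 0 have "endograph u = endograph v"
      using H_end_eq_0D[of u v] H_end_eq_0D[of v u] uv by blast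
    with uv show "u = v" by (intro endograph_inject)
  next
    assume "u = v"
    then have "H_end u v \<le> 0" using uv by (intro H_end_least) simp_all
    moreover have "0 \<le> H_end u v" by (simp add: H_end_def hausdorff_dist_nonneg)
    ultimately show "H_end u v = 0" by simp
  qed
  assume "w \<in> F_USCB"
  then have w: "fuzzy_set w" by (auto simp: F_USCB_def)
  show "H_end u w \<le> H_end u v + H_end v w"
  proof (rule H_end_least)
    fix a assume "a \<in> endograph w"
    then have "infdist a (endograph u) \<le> H_end w v + H_end v u"
      using uv w by (intro infdist_endograph_triangle)
    then show "infdist a (endograph u) \<le> H_end u v + H_end v w"
      by (simp add: H_end_commute[of w v] H_end_commute[of v u])
  qed (use uv w in \<open>auto intro: infdist_endograph_triangle\<close>)
qed

end

theory Submission
  imports Defs "HOL-Complex_Analysis.Great_Picard"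
begin

text \<open>
  The quantity \<open>end_norm r u\<close> measures, in the endograph metric, how far \<open>u\<close> sticks out of the
  solid block over the ball of radius \<open>r\<close>.  Two facts tie it to the topology.  If \<open>v\<close> is supported
  in that ball, the endograph of \<open>v\<close> lies inside the block, so \<open>end_norm r u \<le> H_end u v\<close>
  (\<open>end_norm_le_H_end\<close>).  Conversely, if \<open>end_norm r u < t\<close>, then \<open>u\<close> can reach the height \<open>t\<close> only
  within distance \<open>t\<close> of the ball (\<open>norm_less_if_end_norm_less\<close>).

  Relative compactness means that every sequence in \<open>U\<close> has a subsequence converging to some
  member of the space.  The limit has bounded support, so the first fact yields the condition on
  \<open>end_norm\<close>, and the second fact turns that condition into boundedness of the cuts: a sequence of
  points of \<open>U(\<alpha>)\<close> running off to infinity would contradict it.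

  For the converse, a closed set is encoded by its distance function.  The distance functions of
  the endographs are 1-Lipschitz, so by Arzela-Ascoli a subsequence of them converges uniformly on
  a compact cylinder that is slightly wider than the ball of radius \<open>r\<close>.  The zero set of the
  limit, together with the hyperplane at height 0, is closed and contains with each point all
  points below it, hence is the endograph of some \<open>w\<close> supported in the cylinder
  (\<open>endograph_of_closed_hypograph\<close>).  Uniform convergence on the cylinder controls the Hausdorff
  distance there; outside the cylinder the second fact says that the endographs are nearly flat, so
  they are close to the hyperplane that every endograph contains.
\<close>

section \<open>Relative compactness by sequences\<close>

lemma (in Metric_space) compact_closure_of_sequentially:
  assumes "S \<subseteq> M"
  shows "compactin mtopology (mtopology closure_of S) \<longleftrightarrow>
    (\<forall>\<sigma>::nat \<Rightarrow> 'a. range \<sigma> \<subseteq> S \<longrightarrow>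
      (\<exists>l r. l \<in> M \<and> strict_mono r \<and> limitin mtopology (\<sigma> \<circ> r) l sequentially))"
proof -
  have D: "M \<inter> mtopology derived_set_of T = mtopology derived_set_of T" for T
    using derived_set_of_subset_topspace[of mtopology T] by auto
  show ?thesis
    unfolding compact_closure_of_eq_Bolzano_Weierstrass
      Bolzano_Weierstrass_property[OF assms assms] D
    using assms by blast
qed

section \<open>Endographs and the endograph metric\<close>

lemma H_end_nonneg: "0 \<le> H_end u v"
  by (simp add: H_end_def hausdorff_dist_nonneg)

lemma fuzzy_set_iff: "fuzzy_set u \<longleftrightarrow> (\<forall>x. 0 \<le> u x \<and> u x \<le> 1)"
  by (auto simp: fuzzy_set_def image_subset_iff)

lemma fuzzy_set_ball_char: "fuzzy_set (ball_char r)"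
  by (simp add: fuzzy_set_iff ball_char_def indicator_def)

lemma fuzzy_set_max: "fuzzy_set u \<Longrightarrow> fuzzy_set v \<Longrightarrow> fuzzy_set (\<lambda>x. max (u x) (v x))"
  by (auto simp: fuzzy_set_iff max_def)

lemma H_end_lessD:
  assumes "fuzzy_set u" "fuzzy_set v" "H_end u v < c" "a \<in> endograph u"
  obtains b where "b \<in> endograph v" "dist a b < c"
proof -
  have "(INF b\<in>endograph v. dist a b) < c"
    using infdist_le_H_end[OF assms(4,1,2)] assms(3) endograph_nonempty[OF assms(2)]
    by (simp add: infdist_notempty)
  then show thesis
    using cInf_lessD[of "dist a ` endograph v" c] endograph_nonempty[OF assms(2)] that by blast
qed

text \<open>
  Moving a point of an endograph vertically downwards does not increase its distance to any other
  endograph, since a nearby point can be lowered to the same height.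
\<close>

lemma infdist_endograph_mono:
  assumes "fuzzy_set u" "0 \<le> s" "s \<le> t"
  shows "infdist (x, s) (endograph u) \<le> infdist (x, t) (endograph u)"
  unfolding infdist_notempty[OF endograph_nonempty[OF assms(1)], of "(x, t)"]
proof (rule cINF_greatest[OF endograph_nonempty[OF assms(1)]])
  fix b assume b: "b \<in> endograph u"
  obtain y q where bq: "b = (y, q)" by (cases b)
  have "(y, min q s) \<in> endograph u"
    using b assms by (auto simp: bq endograph_def)
  then have "infdist (x, s) (endograph u) \<le> dist (x, s) (y, min q s)"
    by (rule infdist_le)
  also have "\<dots> \<le> dist (x, t) (y, q)"
    unfolding dist_Pair_Pair using assms(3)
    by (intro real_sqrt_le_mono add_left_mono power_mono) (auto simp: dist_real_def)
  finally show "infdist (x, s) (endograph u) \<le> dist (x, t) b"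
    by (simp add: bq)
qed

lemma infdist_endograph_le_height:
  assumes "fuzzy_set u" "0 \<le> t"
  shows "infdist (x, t) (endograph u) \<le> t"
  using infdist_le[OF zero_in_endograph[OF assms(1)], of "(x, t)" x] assms(2)
  by (simp add: dist_Pair_Pair)

lemma endograph_of_closed_hypograph:
  fixes L :: "((real ^ 'n) \<times> real) set"
  assumes "closed L" "L \<subseteq> UNIV \<times> {0..1}" "\<And>x. (x, 0) \<in> L"
    and down: "\<And>x s t. (x, t) \<in> L \<Longrightarrow> 0 \<le> s \<Longrightarrow> s \<le> t \<Longrightarrow> (x, s) \<in> L"
  obtains w where "fuzzy_set w" "upper_semicont w" "endograph w = L"
proof -
  define w where "w x = Sup {t. (x, t) \<in> L}" for x
  have slice: "closed {t. (x, t) \<in> L}" for x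
    using closed_vimage[OF assms(1), of "\<lambda>t. (x, t)"]
    by (simp add: vimage_def continuous_on_Pair)
  have bdd: "bdd_above {t. (x, t) \<in> L}" for x
    using assms(2) by (auto intro!: bdd_aboveI[where M = 1])
  have top: "(x, w x) \<in> L" for x
    using closed_contains_Sup[OF _ bdd slice, of x] assms(3)[of x] by (auto simp: w_def)
  have upper: "t \<le> w x" if "(x, t) \<in> L" for x t
    unfolding w_def using that bdd by (intro cSup_upper) auto
  have mem: "(x, t) \<in> L \<longleftrightarrow> 0 \<le> t \<and> t \<le> w x" for x t
    using upper[of x t] down[OF top, of t x] subsetD[OF assms(2), of "(x, t)"] by auto
  have fuzzy: "fuzzy_set w"
    using subsetD[OF assms(2) top] by (simp add: fuzzy_set_iff)
  have "upper_semicont w"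
    unfolding upper_semicont_def
  proof (intro allI impI)
    fix x c assume c: "w x < c"
    have "closed {y. (y, c) \<in> L}"
      using closed_vimage[OF assms(1), of "\<lambda>y. (y, c)"]
      by (simp add: vimage_def continuous_on_Pair)
    then have "open (- {y. (y, c) \<in> L})" by (simp add: open_Compl)
    moreover have "x \<in> - {y. (y, c) \<in> L}" using c mem by auto
    moreover have "w y < c" if "y \<in> - {y. (y, c) \<in> L}" for y
    proof -
      have "0 \<le> c" using c fuzzy by (meson fuzzy_set_iff less_imp_le order_trans)
      then show ?thesis using that by (simp add: mem)
    qed
    ultimately show "\<forall>\<^sub>F y in nhds x. w y < c"
      unfolding eventually_nhds by blast
  qed
  moreover have "endograph w = L"
    using fuzzy by (auto simp: endograph_def mem fuzzy_set_iff intro: order_trans)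
  ultimately show thesis using fuzzy that by blast
qed

section \<open>The distance to a solid ball\<close>

lemma end_norm_le_H_end:
  fixes u v :: "real ^ 'n \<Rightarrow> real"
  assumes u: "fuzzy_set u" and v: "fuzzy_set v" and supp: "{x. v x > 0} \<subseteq> cball 0 r"
  shows "end_norm r u \<le> H_end u v"
  unfolding end_norm_def
proof (rule H_end_least)
  let ?B = "ball_char r :: real ^ 'n \<Rightarrow> real"
  have sub: "endograph v \<subseteq> endograph ?B"
  proof
    fix a assume "a \<in> endograph v"
    then obtain x t where a: "a = (x, t)" "0 \<le> t" "t \<le> 1" "t \<le> v x"
      by (auto simp: endograph_def)
    then have "t \<le> ?B x"
      using supp by (cases "t = 0") (auto simp: ball_char_def indicator_def subset_iff)
    then show "a \<in> endograph ?B" using a by (simp add: endograph_def)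
  qed
  show "infdist a (endograph ?B) \<le> H_end u v"
    if a: "a \<in> endograph (\<lambda>x. max (u x) (?B x))" for a
  proof (cases "a \<in> endograph u")
    case True
    have "infdist a (endograph ?B) \<le> infdist a (endograph v)"
      by (rule infdist_mono[OF sub endograph_nonempty[OF v]])
    also have "\<dots> \<le> H_end u v"
      by (rule infdist_le_H_end[OF True u v])
    finally show ?thesis .
  next
    case False
    then have "a \<in> endograph ?B"
      using a by (auto simp: endograph_def max_def split: if_splits)
    then show ?thesis by (simp add: H_end_nonneg)
  qed
  show "infdist a (endograph (\<lambda>x. max (u x) (?B x))) \<le> H_end u v" if "a \<in> endograph ?B" for a
  proof -
    have "a \<in> endograph (\<lambda>x. max (u x) (?B x))"
      using that by (auto simp: endograph_def)
    then show ?thesis by (simp add: H_end_nonneg)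
  qed
qed (intro fuzzy_set_max fuzzy_set_ball_char u)+

text \<open>
  A point of the solid block that is closer to \<open>(x, t)\<close> than \<open>t\<close> has positive height, so it lies
  over the ball itself.
\<close>

lemma norm_less_if_end_norm_less:
  fixes u :: "real ^ 'n \<Rightarrow> real"
  assumes u: "fuzzy_set u" and less: "end_norm r u < t" and x: "t \<le> u x"
  shows "norm x < r + t"
proof -
  let ?B = "ball_char r :: real ^ 'n \<Rightarrow> real"
  have "0 < t" using less H_end_nonneg order_le_less_trans unfolding end_norm_def by blast
  moreover have "t \<le> 1" using u x by (meson fuzzy_set_iff order_trans)
  ultimately have "(x, t) \<in> endograph (\<lambda>x. max (u x) (?B x))"
    using x by (simp add: endograph_def)
  then obtain b where b: "b \<in> endograph ?B" "dist (x, t) b < t"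
    using H_end_lessD[OF fuzzy_set_max[OF u fuzzy_set_ball_char] fuzzy_set_ball_char]
      less unfolding end_norm_def by metis
  obtain y s where ys: "b = (y, s)" by (cases b)
  have "dist t s < t" "dist x y < t"
    using b(2) dist_snd_le[of "(x, t)" b] dist_fst_le[of "(x, t)" b] by (auto simp: ys)
  then have "0 < s" by (simp add: dist_real_def)
  then have "norm y \<le> r"
    using b(1) by (cases "norm y \<le> r") (auto simp: ys endograph_def ball_char_def)
  with \<open>dist x y < t\<close> show ?thesis
    using norm_triangle_ineq2[of x y] by (simp add: dist_norm)
qed

section \<open>Extraction of a convergent subsequence\<close>

text \<open>
  The passage from uniform convergence of distance functions back to closeness of the sets: \<open>f\<close> has
  a positive minimum on the compact set of points of \<open>K\<close> at distance at least \<open>e\<close> from \<open>L\<close>.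
\<close>

lemma small_imp_near_zeros:
  fixes f :: "'a::metric_space \<Rightarrow> real"
  assumes "compact K" "continuous_on K f" "\<And>z. z \<in> K \<Longrightarrow> 0 \<le> f z"
    and zeros: "\<And>z. z \<in> K \<Longrightarrow> f z = 0 \<Longrightarrow> z \<in> L" and "0 < e"
  obtains d where "0 < d" "\<And>z. z \<in> K \<Longrightarrow> f z < d \<Longrightarrow> infdist z L < e"
proof -
  define K' where "K' = K \<inter> {z. e \<le> infdist z L}"
  have "compact K'"
    unfolding K'_def
    by (intro compact_Int_closed assms closed_Collect_le continuous_intros)
  show thesis
  proof (cases "K' = {}")
    case True
    then show thesis using that[of 1] by (force simp: K'_def)
  next
    case False
    have "continuous_on K' f"
      using assms(2) by (rule continuous_on_subset) (auto simp: K'_def)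
    then obtain z0 where z0: "z0 \<in> K'" "\<And>z. z \<in> K' \<Longrightarrow> f z0 \<le> f z"
      using continuous_attains_inf[OF \<open>compact K'\<close> False] by blast
    have "f z0 \<noteq> 0"
      using zeros[of z0] z0(1) \<open>0 < e\<close> by (auto simp: K'_def)
    then have "0 < f z0"
      using assms(3)[of z0] z0(1) by (simp add: K'_def)
    then show thesis
      using that[of "f z0"] z0(2) by (force simp: K'_def)
  qed
qed

lemma H_end_convergent_subsequence:
  fixes v :: "nat \<Rightarrow> real ^ 'n \<Rightarrow> real"
  assumes v: "\<And>n. fuzzy_set (v n)" and lim: "(\<lambda>n. end_norm r (v n)) \<longlonglongrightarrow> 0"
  obtains k w where "strict_mono (k :: nat \<Rightarrow> nat)" "w \<in> F_USCB" "(\<lambda>n. H_end (v (k n)) w) \<longlonglongrightarrow> 0"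
proof -
  let ?K = "cball (0 :: real ^ 'n) (r + 1) \<times> {0..1::real}"
  let ?F = "\<lambda>n z. infdist z (endograph (v n))"
  have K: "compact ?K" by (intro compact_Times) auto
  obtain f k where f: "continuous_on ?K f" and k: "strict_mono (k :: nat \<Rightarrow> nat)"
    and unif: "\<And>e. 0 < e \<Longrightarrow> \<exists>N. \<forall>n z. n \<ge> N \<and> z \<in> ?K \<longrightarrow> norm (?F (k n) z - f z) < e"
  proof (rule Arzela_Ascoli[OF K, of ?F 1])
    show "norm (?F n z) \<le> 1" if "z \<in> ?K" for n z
      using that infdist_endograph_le_height[OF v, of "snd z" "fst z" n]
      by (auto simp: infdist_nonneg)
    show "\<exists>d>0. \<forall>n y. y \<in> ?K \<and> norm (z - y) < d \<longrightarrow> norm (?F n z - ?F n y) < e"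
      if "0 < e" for z e
      using that infdist_triangle_abs[of z _ y for y]
      by (intro exI[of _ e]) (auto simp: dist_norm intro: order_le_less_trans)
  qed (use that in blast)
  have pointwise: "(\<lambda>n. ?F (k n) z) \<longlonglongrightarrow> f z" if "z \<in> ?K" for z
  proof (rule LIMSEQ_I)
    fix e :: real assume "0 < e"
    from unif[OF this] that show "\<exists>N. \<forall>n\<ge>N. norm (?F (k n) z - f z) < e"
      by blast
  qed
  have f_nonneg: "0 \<le> f z" if "z \<in> ?K" for z
    using LIMSEQ_le_const[OF pointwise[OF that]] infdist_nonneg by blast
  have f_mono: "f (x, s) \<le> f (x, t)" if "(x, t) \<in> ?K" "0 \<le> s" "s \<le> t" for x s t
  proof (rule LIMSEQ_le[OF pointwise pointwise])
    show "\<exists>N. \<forall>n\<ge>N. ?F (k n) (x, s) \<le> ?F (k n) (x, t)"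
      using infdist_endograph_mono[OF v that(2,3)] by blast
  qed (use that in auto)
  \<comment> \<open>The zero set of \<open>f\<close> is the part of the limit over the cylinder.\<close>
  define L where "L = UNIV \<times> {0} \<union> {z \<in> ?K. f z = 0}"
  have "closed {z \<in> ?K. f z = 0}"
    using continuous_closed_preimage_constant[OF f] compact_imp_closed[OF K] by simp
  then have "closed L"
    unfolding L_def by (intro closed_Un closed_Times) auto
  moreover have "(x, s) \<in> L" if "(x, t) \<in> L" "0 \<le> s" "s \<le> t" for x s t
  proof (cases "s = 0")
    case False
    then have "(x, t) \<in> ?K" "f (x, t) = 0" using that by (auto simp: L_def)
    moreover from this have "(x, s) \<in> ?K" using that by auto
    ultimately show ?thesis
      using f_mono[of x t s] f_nonneg[of "(x, s)"] that by (auto simp: L_def)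
  qed (simp add: L_def)
  moreover have "L \<subseteq> UNIV \<times> {0..1}" "(x, 0) \<in> L" for x
    by (auto simp: L_def)
  ultimately obtain w where w: "fuzzy_set w" "upper_semicont w" and L: "endograph w = L"
    using endograph_of_closed_hypograph[of L] by blast
  have supp: "{x. 0 < w x} \<subseteq> cball 0 (r + 1)"
  proof
    fix x assume "x \<in> {x. 0 < w x}"
    moreover have "(x, w x) \<in> endograph w"
      using w(1) by (simp add: endograph_def fuzzy_set_iff)
    ultimately show "x \<in> cball 0 (r + 1)"
      by (auto simp: L L_def)
  qed
  have "bounded (fcut w 0)"
    using bounded_subset[OF bounded_cball supp] by (simp add: fcut_def bounded_closure)
  with w have "w \<in> F_USCB" by (simp add: F_USCB_def)
  moreover have "(\<lambda>n. H_end (v (k n)) w) \<longlonglongrightarrow> 0"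
  proof (rule LIMSEQ_I)
    fix e0 :: real assume "0 < e0"
    \<comment> \<open>With \<open>e < 1\<close>, the parts of the endographs above height \<open>e\<close> eventually lie in the cylinder.\<close>
    define e where "e = min (e0 / 2) (1 / 2)"
    have e: "0 < e" "e < e0" "e < 1" using \<open>0 < e0\<close> by (auto simp: e_def)
    obtain d where d: "0 < d" "\<And>z. z \<in> ?K \<Longrightarrow> f z < d \<Longrightarrow> infdist z L < e"
      using small_imp_near_zeros[OF K f f_nonneg _ e(1), of L] by (auto simp: L_def)
    obtain N where N: "\<And>n z. n \<ge> N \<Longrightarrow> z \<in> ?K \<Longrightarrow> \<bar>?F (k n) z - f z\<bar> < min d e"
    proof -
      have "0 < min d e" using d(1) e(1) by simp
      from unif[OF this] show thesis using that unfolding real_norm_def by blast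
    qed
    have "eventually (\<lambda>n. end_norm r (v (k n)) < e) sequentially"
      using order_tendstoD(2)[OF LIMSEQ_subseq_LIMSEQ[OF lim k]] e(1) by (simp add: o_def)
    then obtain N' where N': "\<And>n. n \<ge> N' \<Longrightarrow> end_norm r (v (k n)) < e"
      unfolding eventually_sequentially by blast
    have "H_end (v (k n)) w \<le> e" if n: "n \<ge> max N N'" for n
    proof (rule H_end_least[OF v w(1)])
      fix a assume a: "a \<in> endograph (v (k n))"
      obtain x t where xt: "a = (x, t)" by (cases a)
      have t: "0 \<le> t" "t \<le> 1" "t \<le> v (k n) x"
        using a by (auto simp: xt endograph_def)
      show "infdist a (endograph w) \<le> e"
      proof (cases "t \<le> e")
        case True
        then show ?thesis
          using infdist_endograph_le_height[OF w(1) t(1), of x] by (simp add: xt)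
      next
        case False
        then have "norm x < r + e"
          using norm_less_if_end_norm_less[OF v N', of n x] n t(3) by simp
        then have "a \<in> ?K" using e(3) t by (simp add: xt)
        moreover from this have "f a < d"
          using N[of n a] n a by (simp add: abs_less_iff)
        ultimately show ?thesis using d(2) by (force simp: L)
      qed
    next
      fix a assume "a \<in> endograph w"
      then consider x where "a = (x, 0)" | "a \<in> ?K" "f a = 0"
        by (auto simp: L L_def)
      then show "infdist a (endograph (v (k n))) \<le> e"
      proof cases
        case 1
        then show ?thesis using zero_in_endograph[OF v] e(1) by simp
      next
        case 2
        then show ?thesis using N[of n a] n by (simp add: abs_less_iff)
      qed
    qed
    then show "\<exists>N. \<forall>n\<ge>N. norm (H_end (v (k n)) w - 0) < e0"
      using e(2) by (intro exI[of _ "max N N'"]) (auto simp: H_end_nonneg intro: order_le_less_trans)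
  qed
  ultimately show thesis using k that by blast
qed

section \<open>The characterization of relative compactness\<close>

lemma limitin_F_USCB_iff:
  assumes "range \<sigma> \<subseteq> F_USCB" "w \<in> F_USCB"
  shows "limitin (Metric_space.mtopology F_USCB H_end) \<sigma> w sequentially \<longleftrightarrow>
    (\<lambda>n. H_end (\<sigma> n) w) \<longlonglongrightarrow> 0"
  using assms
  by (auto simp: Metric_space.limitin_metric[OF Metric_space_F_USCB] tendsto_iff H_end_nonneg
      image_subset_iff)

text \<open>
  Boundedness of the cuts by contradiction: along any subsequence for which \<open>end_norm\<close> tends to 0,
  the points at height \<open>\<alpha>\<close> eventually stay within distance \<open>\<alpha>\<close> of a fixed ball.
\<close>

lemma bounded_Union_fcut:
  fixes U :: "(real ^ 'n \<Rightarrow> real) set"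
  assumes U: "\<And>u. u \<in> U \<Longrightarrow> fuzzy_set u"
    and sub: "\<And>u :: nat \<Rightarrow> _. range u \<subseteq> U \<Longrightarrow>
      \<exists>r>0. \<exists>s. strict_mono (s :: nat \<Rightarrow> nat) \<and> (\<lambda>n. end_norm r (u (s n))) \<longlonglongrightarrow> 0"
    and "0 < \<alpha>"
  shows "bounded (\<Union>u\<in>U. fcut u \<alpha>)"
proof (rule ccontr)
  assume "\<not> bounded (\<Union>u\<in>U. fcut u \<alpha>)"
  then have "\<forall>n. \<exists>x u. u \<in> U \<and> \<alpha> \<le> u x \<and> real n < norm x"
    using \<open>0 < \<alpha>\<close> by (fastforce simp: bounded_iff fcut_def not_le)
  then obtain x u where xu: "\<And>n. u n \<in> U" "\<And>n. \<alpha> \<le> u n (x n)" "\<And>n. real n < norm (x n)"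
    by metis
  obtain r s where s: "strict_mono (s :: nat \<Rightarrow> nat)" "(\<lambda>n. end_norm r (u (s n))) \<longlonglongrightarrow> 0"
    using sub[of u] xu(1) by blast
  obtain N where N: "\<And>n. n \<ge> N \<Longrightarrow> end_norm r (u (s n)) < \<alpha>"
    using order_tendstoD(2)[OF s(2) \<open>0 < \<alpha>\<close>] unfolding eventually_sequentially by blast
  obtain m :: nat where m: "r + \<alpha> < real m" using reals_Archimedean2 by blast
  let ?n = "max N m"
  have "norm (x (s ?n)) < r + \<alpha>"
    by (rule norm_less_if_end_norm_less[OF U[OF xu(1)] N xu(2)]) simp
  also have "\<dots> < real (s ?n)"
    using m strict_mono_imp_increasing[OF s(1), of ?n] by linarith
  finally show False using xu(3)[of "s ?n"] by simp
qed

theorem theorem8p6: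
  fixes U :: "(real ^ 'n \<Rightarrow> real) set"
  assumes "U \<subseteq> F_USCB"
  shows "relatively_compact_in (Metric_space.mtopology F_USCB H_end) U \<longleftrightarrow>
    (\<forall>\<alpha>\<in>{0<..1}. bounded (\<Union>u\<in>U. fcut u \<alpha>)) \<and>
    (\<forall>u :: nat \<Rightarrow> real ^ 'n \<Rightarrow> real. range u \<subseteq> U \<longrightarrow>
      (\<exists>r>0. \<exists>s :: nat \<Rightarrow> nat. strict_mono s \<and> (\<lambda>n. end_norm r (u (s n))) \<longlonglongrightarrow> 0))"
    (is "?lhs \<longleftrightarrow> ?cuts \<and> ?tails")
proof -
  have fuzzy: "fuzzy_set u" if "u \<in> U" for u
    using that assms by (auto simp: F_USCB_def)
  have lhs: "?lhs \<longleftrightarrow> (\<forall>\<sigma>::nat \<Rightarrow> _. range \<sigma> \<subseteq> U \<longrightarrow>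
      (\<exists>w s. w \<in> F_USCB \<and> strict_mono (s :: nat \<Rightarrow> nat) \<and> (\<lambda>n. H_end (\<sigma> (s n)) w) \<longlonglongrightarrow> 0))"
  proof -
    have "limitin (Metric_space.mtopology F_USCB H_end) (\<sigma> \<circ> s) w sequentially \<longleftrightarrow>
        (\<lambda>n. H_end (\<sigma> (s n)) w) \<longlonglongrightarrow> 0"
      if "range \<sigma> \<subseteq> U" "w \<in> F_USCB" for \<sigma> w and s :: "nat \<Rightarrow> nat"
      using limitin_F_USCB_iff[of "\<sigma> \<circ> s" w] that assms by (auto simp: o_def)
    then show ?thesis
      unfolding relatively_compact_in_def
        Metric_space.compact_closure_of_sequentially[OF Metric_space_F_USCB assms]
      by metis
  qed
  show ?thesis
  proof (intro iffI conjI)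
    assume ?lhs
    show tails: ?tails
    proof (intro allI impI)
      fix u :: "nat \<Rightarrow> real ^ 'n \<Rightarrow> real" assume u: "range u \<subseteq> U"
      obtain w s where w: "w \<in> F_USCB" and s: "strict_mono (s :: nat \<Rightarrow> nat)"
        and lim: "(\<lambda>n. H_end (u (s n)) w) \<longlonglongrightarrow> 0"
        using \<open>?lhs\<close> u unfolding lhs by blast
      have "bounded {x. 0 < w x}"
        using w bounded_subset[OF _ closure_subset] by (auto simp: F_USCB_def fcut_def)
      then obtain r where r: "0 < r" "{x. 0 < w x} \<subseteq> cball 0 r"
        by (auto simp: bounded_pos subset_iff)
      have "(\<lambda>n. end_norm r (u (s n))) \<longlonglongrightarrow> 0"
      proof (rule tendsto_sandwich[OF _ _ tendsto_const lim])
        show "\<forall>\<^sub>F n in sequentially. end_norm r (u (s n)) \<le> H_end (u (s n)) w"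
          using u w r(2) fuzzy
          by (intro always_eventually allI end_norm_le_H_end) (auto simp: F_USCB_def)
      qed (simp add: end_norm_def H_end_nonneg)
      with r(1) s show "\<exists>r>0. \<exists>s :: nat \<Rightarrow> nat. strict_mono s \<and>
          (\<lambda>n. end_norm r (u (s n))) \<longlonglongrightarrow> 0"
        by blast
    qed
    show ?cuts
      using bounded_Union_fcut[OF fuzzy] tails by simp
  next
    assume "?cuts \<and> ?tails"
    show ?lhs
      unfolding lhs
    proof (intro allI impI)
      fix u :: "nat \<Rightarrow> real ^ 'n \<Rightarrow> real" assume u: "range u \<subseteq> U"
      then obtain r s where s: "strict_mono (s :: nat \<Rightarrow> nat)"
        and lim: "(\<lambda>n. end_norm r (u (s n))) \<longlonglongrightarrow> 0"
        using \<open>?cuts \<and> ?tails\<close> by blast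
      have "fuzzy_set (u (s n))" for n using u fuzzy by auto
      then obtain k w where "strict_mono (k :: nat \<Rightarrow> nat)" "w \<in> F_USCB"
        "(\<lambda>n. H_end (u (s (k n))) w) \<longlonglongrightarrow> 0"
        using H_end_convergent_subsequence[OF _ lim] by blast
      moreover from s this(1) have "strict_mono (s \<circ> k)"
        by (rule strict_mono_o)
      ultimately show "\<exists>w s. w \<in> F_USCB \<and> strict_mono (s :: nat \<Rightarrow> nat) \<and>
          (\<lambda>n. H_end (u (s n)) w) \<longlonglongrightarrow> 0"
        by (intro exI[of _ w] exI[of _ "s \<circ> k"]) (simp add: o_def)
    qed
  qed
qed

end
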